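(* Let $d\ge2$, let $a_1,\dots,a_d>0$, $a=\sum_{i=1}^d a_i$, and let $\rho\ge1$ be an integer. Let $\widehat K_v$ be the CAST-$\rho$ update. Then, for every realization of the sampled spanning tree $T$, the terminal support graph of $\widehat K_v$ is connected on the set of terminals $\{u_1,\dots,u_d\}$.
   Context: The terminals $u_1,\dots,u_d$ are the neighbors of an eliminated pivot vertex $v$, identified with $[d]$; $a_i$ is the weight of the edge $vu_i$; $\mathbf e_i\in\mathbb R^d$ is the standard basis vector of $u_i$. CAST-$\rho$ update. For each $i\in[d]$ let $P_i=\{(i,1),\dots,(i,\rho)\}$ be a block of $\rho$ auxiliary copies, each $p\in P_i$ having conductance $c_p=a_i/\rho$ and label $\phi(p)=i$. Let $P=\bigcup_i P_i$. The expanded Schur clique is the complete graph on $P$ with edge weights $w^{\mathrm{exp}}_{pq}=c_pc_q/a$ for $p\ne q$. Let $T$ be a random spanning tree of it with $\mathbb P(T)\propto\prod_{(p,q)\in T}w^{\mathrm{exp}}_{pq}$. Then $$\widehat K_v=\sum_{(p,q)\in T,\ \phi(p)\ne\phi(q)}\frac{c_pc_q}{c_p+c_q}\,(\mathbf e_{\phi(p)}-\mathbf e_{\phi(q)})(\mathbf e_{\phi(p)}-\mathbf e_{\phi(q)})^\top .$$ The support graph of a weighted graph Laplacian is the graph formed by its edges of positive (aggregated) weight, i.e. $u_i\sim u_j$ ($i\ne j$) iff the $(i,j)$ entry of $\widehat K_v$ is nonzero. *)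

theory Defs
  imports "HOL-Probability.Probability"
begin

section \<open>Simple undirected graphs\<close>

text \<open>A graph is given by a vertex set and a set of two-element vertex sets. (The trees of
  \<^verbatim>\<open>Graph_Theory\<close> only exclude directed cycles and so are not trees in the undirected sense.)\<close>

definition complete_edges :: "'v set \<Rightarrow> 'v set set" where
  "complete_edges V = {{p, q} | p q. p \<in> V \<and> q \<in> V \<and> p \<noteq> q}"

definition adjacency :: "'v set \<Rightarrow> 'v set set \<Rightarrow> ('v \<times> 'v) set" where
  "adjacency V E = {(x, y). x \<in> V \<and> y \<in> V \<and> {x, y} \<in> E}"

definition graph_connected :: "'v set \<Rightarrow> 'v set set \<Rightarrow> bool" where
  "graph_connected V E \<longleftrightarrow> V \<noteq> {} \<and> (\<forall>x\<in>V. \<forall>y\<in>V. (x, y) \<in> (adjacency V E)\<^sup>*)"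

text \<open>A cycle is listed without repeating its first vertex at the end.\<close>

definition graph_cycle :: "'v set set \<Rightarrow> 'v list \<Rightarrow> bool" where
  "graph_cycle E vs \<longleftrightarrow> 3 \<le> length vs \<and> distinct vs \<and>
     (\<forall>k<length vs. {vs ! k, vs ! (Suc k mod length vs)} \<in> E)"

definition spanning_trees :: "'v set \<Rightarrow> 'v set set \<Rightarrow> 'v set set set" where
  "spanning_trees V E = {T. T \<subseteq> E \<and> graph_connected V T \<and> (\<nexists>vs. graph_cycle T vs)}"

text \<open>The law proportional to the product of edge weights. This is meaningful only for a finite
  graph with positive weights and at least one spanning tree;
  see \<open>pmf_random_spanning_tree\<close> and \<open>set_pmf_random_spanning_tree\<close> below.\<close>

definition random_spanning_tree :: "'v set \<Rightarrow> 'v set set \<Rightarrow> ('v set \<Rightarrow> real) \<Rightarrow> 'v set set pmf" where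
  "random_spanning_tree V E w = embed_pmf (\<lambda>T. if T \<in> spanning_trees V E
     then (\<Prod>e\<in>T. w e) / (\<Sum>T'\<in>spanning_trees V E. \<Prod>e\<in>T'. w e) else 0)"

lemma
  assumes fin: "finite E" and ne: "spanning_trees V E \<noteq> {}" and pos: "\<And>e. e \<in> E \<Longrightarrow> w e > 0"
  shows pmf_random_spanning_tree: "pmf (random_spanning_tree V E w) T = (if T \<in> spanning_trees V E
     then (\<Prod>e\<in>T. w e) / (\<Sum>T'\<in>spanning_trees V E. \<Prod>e\<in>T'. w e) else 0)"
    and set_pmf_random_spanning_tree: "set_pmf (random_spanning_tree V E w) = spanning_trees V E"
proof -
  let ?S = "spanning_trees V E"
  let ?W = "\<lambda>T. \<Prod>e\<in>T. w e"
  let ?f = "\<lambda>T. if T \<in> ?S then ?W T / (\<Sum>T'\<in>?S. ?W T') else 0"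
  have finS: "finite ?S"
    by (rule finite_subset[of _ "Pow E"]) (auto simp: spanning_trees_def fin)
  have Wpos: "?W T > 0" if "T \<in> ?S" for T
    using that pos by (intro prod_pos) (auto simp: spanning_trees_def)
  have Zpos: "(\<Sum>T'\<in>?S. ?W T') > 0"
    using Wpos ne finS by (intro sum_pos) auto
  have nonneg: "?f T \<ge> 0" for T
    using Wpos[of T] Zpos by (auto intro!: divide_nonneg_pos)
  have "(\<integral>\<^sup>+T. ennreal (?f T) \<partial>count_space UNIV) = (\<Sum>T\<in>?S. ennreal (?f T))"
    by (rule nn_integral_count_space'[OF finS]) auto
  also have "\<dots> = ennreal (\<Sum>T\<in>?S. ?f T)"
    using nonneg by (rule sum_ennreal)
  also have "(\<Sum>T\<in>?S. ?f T) = (\<Sum>T\<in>?S. ?W T / (\<Sum>T'\<in>?S. ?W T'))"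
    by (intro sum.cong) auto
  also have "\<dots> = 1"
    using Zpos by (simp add: sum_divide_distrib[symmetric])
  finally have one: "(\<integral>\<^sup>+T. ennreal (?f T) \<partial>count_space UNIV) = 1" by simp
  show P: "pmf (random_spanning_tree V E w) T = ?f T" for T
    unfolding random_spanning_tree_def by (rule pmf_embed_pmf[OF nonneg one])
  have "?f T \<noteq> 0 \<longleftrightarrow> T \<in> ?S" for T
    using Wpos[of T] Zpos by auto
  then show "set_pmf (random_spanning_tree V E w) = ?S"
    unfolding set_eq_iff set_pmf_iff P by blast
qed

lemma spanning_trees_complete_nonempty:
  assumes "V \<noteq> {}"
  shows "spanning_trees V (complete_edges V) \<noteq> {}"
proof -
  obtain r where r: "r \<in> V" using assms by blast
  define T where "T = {{r, x} | x. x \<in> V \<and> x \<noteq> r}"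
  have sub: "T \<subseteq> complete_edges V"
    using r by (auto simp: T_def complete_edges_def)
  have edge: "(r, x) \<in> adjacency V T \<and> (x, r) \<in> adjacency V T" if "x \<in> V" "x \<noteq> r" for x
  proof -
    have "{r, x} \<in> T" using that by (auto simp: T_def)
    then show ?thesis using r that by (simp add: adjacency_def insert_commute)
  qed
  have to: "(r, x) \<in> (adjacency V T)\<^sup>*" "(x, r) \<in> (adjacency V T)\<^sup>*" if "x \<in> V" for x
    using edge[OF that] by (metis r_into_rtrancl rtrancl.rtrancl_refl)+
  have conn: "graph_connected V T"
    unfolding graph_connected_def using assms to by (meson rtrancl_trans)
  have "\<not> graph_cycle T vs" for vs
  proof
    assume c: "graph_cycle T vs"
    define n where "n = length vs"
    have n: "3 \<le> n" and d: "distinct vs" using c by (auto simp: graph_cycle_def n_def)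
    have E: "vs ! k = r \<or> vs ! (Suc k mod n) = r" if "k < n" for k
    proof -
      have "{vs ! k, vs ! (Suc k mod n)} \<in> T" using c that by (auto simp: graph_cycle_def n_def)
      then show ?thesis by (auto simp: T_def doubleton_eq_iff)
    qed
    have inj: "i = j" if "i < n" "j < n" "vs ! i = r" "vs ! j = r" for i j
      using d that nth_eq_iff_index_eq[of vs i j] by (simp add: n_def)
    have e0: "vs ! 0 = r \<or> vs ! 1 = r" using E[of 0] n by simp
    have e1: "vs ! 1 = r \<or> vs ! 2 = r" using E[of 1] n by (simp add: numeral_2_eq_2)
    have v1: "vs ! 1 = r" using e0 e1 inj[of 0 2] n by linarith
    have e2: "vs ! 2 = r \<or> vs ! (3 mod n) = r"
      using E[of 2] n by (simp add: numeral_3_eq_3 numeral_2_eq_2)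
    have "3 mod n \<noteq> 1 \<and> 3 mod n < n" using n by (cases "n = 3") simp_all
    then show False using e2 v1 inj[of 2 1] inj[of "3 mod n" 1] n by linarith
  qed
  with sub conn show ?thesis by (auto simp: spanning_trees_def)
qed

section \<open>The CAST-\<open>\<rho>\<close> update\<close>

text \<open>The terminals \<open>[d]\<close> are the elements of a finite type \<open>'d\<close>, so \<open>d = CARD('d)\<close>.\<close>

definition aux_copies :: "nat \<Rightarrow> ('d::finite \<times> nat) set" where
  "aux_copies \<rho> = UNIV \<times> {1..\<rho>}"

abbreviation label :: "'d \<times> nat \<Rightarrow> 'd" where
  "label \<equiv> fst"

definition conductance :: "('d::finite \<Rightarrow> real) \<Rightarrow> nat \<Rightarrow> 'd \<times> nat \<Rightarrow> real" where
  "conductance a \<rho> p = a (label p) / real \<rho>"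

text \<open>Taking the product over the two endpoints makes the weight a function of the unordered edge.\<close>

definition expanded_weight :: "('d::finite \<Rightarrow> real) \<Rightarrow> nat \<Rightarrow> ('d \<times> nat) set \<Rightarrow> real" where
  "expanded_weight a \<rho> e = (\<Prod>p\<in>e. conductance a \<rho> p) / (\<Sum>i\<in>UNIV. a i)"

lemma expanded_weight_pair:
  "p \<noteq> q \<Longrightarrow>
    expanded_weight a \<rho> {p, q} = conductance a \<rho> p * conductance a \<rho> q / (\<Sum>i\<in>UNIV. a i)"
  by (simp add: expanded_weight_def)

definition cast_tree :: "('d::finite \<Rightarrow> real) \<Rightarrow> nat \<Rightarrow> ('d \<times> nat) set set pmf" where
  "cast_tree a \<rho> = random_spanning_tree (aux_copies \<rho>) (complete_edges (aux_copies \<rho>))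
     (expanded_weight a \<rho>)"

lemma set_pmf_cast_tree:
  fixes a :: "'d::finite \<Rightarrow> real"
  assumes a: "\<And>i. a i > 0" and "\<rho> \<ge> 1"
  shows "set_pmf (cast_tree a \<rho>) = spanning_trees (aux_copies \<rho>) (complete_edges (aux_copies \<rho>))"
  unfolding cast_tree_def
proof (rule set_pmf_random_spanning_tree)
  let ?P = "aux_copies \<rho> :: ('d \<times> nat) set"
  have "complete_edges ?P \<subseteq> Pow ?P" by (auto simp: complete_edges_def)
  moreover have "finite ?P" by (simp add: aux_copies_def)
  ultimately show "finite (complete_edges ?P)" by (meson finite_Pow_iff finite_subset)
  show "spanning_trees ?P (complete_edges ?P) \<noteq> {}"
    using assms by (intro spanning_trees_complete_nonempty) (auto simp: aux_copies_def)
  have "(\<Sum>i\<in>UNIV. a i) > 0" using a by (intro sum_pos) auto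
  moreover have "conductance a \<rho> p > 0" for p
    using assms by (simp add: conductance_def)
  ultimately show "expanded_weight a \<rho> e > 0" for e
    unfolding expanded_weight_def by (intro divide_pos_pos prod_pos) auto
qed

definition outer_product :: "real ^ 'd::finite \<Rightarrow> real ^ 'd ^ 'd" where
  "outer_product x = (columnvector x :: real ^ 1 ^ 'd) ** rowvector x"

lemma outer_product_nth: "outer_product x $ i $ j = x $ i * x $ j"
  by (simp add: outer_product_def matrix_matrix_mult_def columnvector_def rowvector_def)

text \<open>Each edge \<open>{p, q}\<close> of \<open>T\<close> is met as \<open>(p, q)\<close> and as \<open>(q, p)\<close> with the same summand,
  whence the factor \<open>1/2\<close>.\<close>

definition cast_update ::
    "('d::finite \<Rightarrow> real) \<Rightarrow> nat \<Rightarrow> ('d \<times> nat) set set \<Rightarrow> real ^ 'd ^ 'd" where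
  "cast_update a \<rho> T =
     (1/2) *\<^sub>R (\<Sum>(p, q) \<in> {(p, q). p \<in> aux_copies \<rho> \<and> q \<in> aux_copies \<rho> \<and> {p, q} \<in> T \<and>
                              label p \<noteq> label q}.
        (conductance a \<rho> p * conductance a \<rho> q / (conductance a \<rho> p + conductance a \<rho> q))
          *\<^sub>R outer_product (axis (label p) 1 - axis (label q) 1))"

text \<open>An off-diagonal Laplacian entry is minus the aggregated weight of that edge.\<close>

definition support_edges :: "real ^ 'd::finite ^ 'd \<Rightarrow> 'd set set" where
  "support_edges K = {{i, j} | i j. i \<noteq> j \<and> K $ i $ j \<noteq> 0}"

end

theory Submission
  imports Defs
begin

text \<open>All summands of \<open>cast_update\<close> have nonpositive off-diagonal entries, so they cannot cancel:
  every edge of \<open>T\<close> between two blocks survives in the support graph. Contracting each block to its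
  label therefore maps walks in \<open>T\<close> to walks in the support graph, and \<open>T\<close> is connected.\<close>

text \<open>Each step of a walk in \<open>E\<close> either stays in one fibre of \<open>f\<close>
  and collapses to a point, or changes fibre and becomes an edge of \<open>F\<close>; surjectivity
  onto \<open>W\<close> lifts any two endpoints to \<open>V\<close>.\<close>

lemma graph_connected_contract:
  assumes "graph_connected V E" "f ` V = W"
    and edge: "\<And>x y. \<lbrakk>x \<in> V; y \<in> V; {x, y} \<in> E; f x \<noteq> f y\<rbrakk> \<Longrightarrow> {f x, f y} \<in> F"
  shows "graph_connected W F"
proof -
  have "(f x, f y) \<in> (adjacency W F)\<^sup>*" if "(x, y) \<in> (adjacency V E)\<^sup>*" for x y
    using that
  proof (induction rule: rtrancl_induct)
    case (step y z)
    then have "f y = f z \<or> (f y, f z) \<in> adjacency W F"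
      using assms(2) edge[of y z] by (auto simp: adjacency_def)
    with step.IH show ?case by (metis rtrancl.rtrancl_into_rtrancl)
  qed simp
  with assms(1,2) show ?thesis unfolding graph_connected_def by blast
qed

text \<open>The vector is zero if \<open>k = l\<close>; otherwise its only nonzero entries are 1 and
  -1, so two distinct coordinates multiply to 0 or -1.\<close>

lemma outer_product_axis_diff_nonpos:
  fixes i j k l :: "'d::finite"
  assumes "i \<noteq> j"
  shows "outer_product (axis k 1 - axis l 1) $ i $ j \<le> 0"
  using assms by (auto simp: outer_product_nth axis_def)

lemma cast_update_neg:
  fixes a :: "'d::finite \<Rightarrow> real"
  assumes a: "\<And>i. a i > 0" and "\<rho> \<ge> 1"
    and "p \<in> aux_copies \<rho>" "q \<in> aux_copies \<rho>" "{p, q} \<in> T" "label p \<noteq> label q"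
  shows "cast_update a \<rho> T $ label p $ label q < 0"
proof -
  let ?S = "{(p, q). p \<in> aux_copies \<rho> \<and> q \<in> aux_copies \<rho> \<and> {p, q} \<in> T \<and> label p \<noteq> label q}"
  let ?c = "conductance a \<rho>"
  let ?g = "\<lambda>(r, s). ?c r * ?c s / (?c r + ?c s)
     * outer_product (axis (label r) 1 - axis (label s) 1) $ label p $ label q"
  have c: "?c r > 0" for r
    using assms by (simp add: conductance_def)
  have "finite ?S"
    by (rule finite_subset[of _ "aux_copies \<rho> \<times> aux_copies \<rho>"]) (auto simp: aux_copies_def)
  moreover have "(p, q) \<in> ?S" using assms by simp
  moreover have "?g x \<le> 0" for x
    unfolding split_beta
    by (intro mult_nonneg_nonpos outer_product_axis_diff_nonpos[OF assms(6)] divide_nonneg_pos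
        mult_nonneg_nonneg add_pos_pos c less_imp_le[OF c])
  \<comment> \<open>At its own labels the edge contributes exactly minus its positive
    coefficient.\<close>
  moreover have "?g (p, q) < 0"
    using assms(6) c[of p] c[of q] by (simp add: outer_product_nth axis_def)
  \<comment> \<open>Termwise comparison with the zero function over the finite set
    \<open>?S\<close>, strict at \<open>(p, q)\<close>.\<close>
  ultimately have "sum ?g ?S < 0"
    by (metis (no_types, lifting) sum_strict_mono_ex1 sum.neutral_const)
  moreover have "cast_update a \<rho> T $ label p $ label q = 1/2 * sum ?g ?S"
    by (simp add: cast_update_def split_beta)
  ultimately show ?thesis by simp
qed

theorem theorem4p3:
  fixes a :: "'d::finite \<Rightarrow> real" and \<rho> :: nat
  assumes "CARD('d) \<ge> 2"
    and "\<And>i. a i > 0"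
    and "\<rho> \<ge> 1"
  shows "\<forall>T \<in> set_pmf (cast_tree a \<rho>).
    graph_connected (UNIV :: 'd set) (support_edges (cast_update a \<rho> T))"
proof
  fix T assume "T \<in> set_pmf (cast_tree a \<rho>)"
  then have "graph_connected (aux_copies \<rho>) T"
    by (simp add: set_pmf_cast_tree[OF assms(2,3)] spanning_trees_def)
  then show "graph_connected (UNIV :: 'd set) (support_edges (cast_update a \<rho> T))"
  proof (rule graph_connected_contract)
    \<comment> \<open>Here \<open>\<rho> \<ge> 1\<close> makes every block nonempty, so no terminal
      is missed.\<close>
    show "label ` aux_copies \<rho> = (UNIV :: 'd set)"
      using assms(3) by (simp add: aux_copies_def fst_image_times)
    show "{label p, label q} \<in> support_edges (cast_update a \<rho> T)"
      if "p \<in> aux_copies \<rho>" "q \<in> aux_copies \<rho>" "{p, q} \<in> T" "label p \<noteq> label q" for p q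
      using cast_update_neg[of a \<rho> p q T] assms(2,3) that unfolding support_edges_def by fastforce
  qed
qed

end
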